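(* Let $\theta\in(-1,1)$ and let $(X_n)_{n\in\mathbb{N}}$ be the centered stationary Gaussian AR(1) process with parameter $\theta$. Then the sequence of sample means $\overline{X}_n=\frac1n\sum_{k=1}^nX_k$, $n\in\mathbb{N}$, satisfies a large deviation principle (with speed $n$) in $\mathbb{R}$ with good rate function $$I_{\overline{X}}(c)=\frac{c^2(1-\theta)^2}{2},\qquad c\in\mathbb{R}.$$
   Context: The centered stationary Gaussian AR(1) process with parameter $\theta$, $|\theta|<1$, is defined by $X_{n+1}=\theta X_n+\varepsilon_{n+1}$ for $n\in\mathbb{N}=\{1,2,\dots\}$, where $(\varepsilon_n)_{n\geq2}$ are i.i.d. $\mathcal{N}(0,1)$ random variables and $X_1\sim\mathcal{N}(0,1/(1-\theta^2))$ is independent of $(\varepsilon_n)_{n\geq 2}$. A sequence of random variables $(V_n)$ satisfies a large deviation principle (LDP) with speed $n$ and rate function $J$ if $J:\mathbb{R}\to[0,\infty]$ is lower semicontinuous and (i) for every closed $F\subset\mathbb{R}$, $\limsup_{n\to\infty}\frac1n\log\mathbb{P}(V_n\in F)\leq-\inf_{x\in F}J(x)$; (ii) for every open $G\subset\mathbb{R}$, $-\inf_{x\in G}J(x)\leq\liminf_{n\to\infty}\frac1n\log\mathbb{P}(V_n\in G)$. The rate function is good if its level sets $J^{-1}([0,b])$ are compact for all $b\in\mathbb{R}$. *)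

theory Defs
  imports "HOL-Probability.Probability"
begin

text \<open>
  The process and the innovations are indexed by \<^typ>\<open>nat\<close>; only \<open>X n\<close> with \<open>n \<ge> 1\<close> and
  \<open>\<epsilon> n\<close> with \<open>n \<ge> 2\<close> are meaningful, the other values are unconstrained. The second argument
  of \<^const>\<open>normal_density\<close> is the standard deviation, not the variance.
  Independence of \<open>X 1\<close> and the sequence \<open>(\<epsilon> n)\<close> is independence of the generated
  \<open>\<sigma>\<close>-algebras, since \<open>indep_var\<close> requires both variables to have the same type.
\<close>

locale stationary_gaussian_AR1 = prob_space M
  for M :: "'a measure" +
  fixes \<theta> :: real
    and X :: "nat \<Rightarrow> 'a \<Rightarrow> real"
    and \<epsilon> :: "nat \<Rightarrow> 'a \<Rightarrow> real"
  assumes abs_theta_less_1: "\<bar>\<theta>\<bar> < 1"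
    and AR1_recursion:
      "\<And>n \<omega>. n \<ge> 1 \<Longrightarrow> \<omega> \<in> space M \<Longrightarrow> X (n + 1) \<omega> = \<theta> * X n \<omega> + \<epsilon> (n + 1) \<omega>"
    and innovations_indep: "indep_vars (\<lambda>_. borel) \<epsilon> {2..}"
    and innovations_normal: "\<And>n. n \<ge> 2 \<Longrightarrow> distributed M lborel (\<epsilon> n) (normal_density 0 1)"
    and initial_normal: "distributed M lborel (X 1) (normal_density 0 (sqrt (1 / (1 - \<theta>\<^sup>2))))"
    and initial_indep:
      "indep_set (sets (vimage_algebra (space M) (X 1) borel))
         (sets (vimage_algebra (space M) (\<lambda>\<omega>. \<lambda>n\<in>{2..}. \<epsilon> n \<omega>) (\<Pi>\<^sub>M n\<in>{2..}. borel)))"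

definition sample_mean :: "(nat \<Rightarrow> 'a \<Rightarrow> real) \<Rightarrow> nat \<Rightarrow> 'a \<Rightarrow> real" where
  "sample_mean X n \<omega> = (1 / real n) * (\<Sum>k=1..n. X k \<omega>)"

text \<open>Logarithm of a probability, with the convention \<open>log 0 = -\<infinity>\<close> (whereas \<open>ln 0 = 0\<close>
  for the real logarithm of the library).\<close>

definition log_prob :: "real \<Rightarrow> ereal" where
  "log_prob p = (if p = 0 then - \<infinity> else ereal (ln p))"

definition lower_semicontinuous :: "(real \<Rightarrow> ereal) \<Rightarrow> bool" where
  "lower_semicontinuous J \<longleftrightarrow> (\<forall>x. J x \<le> Liminf (at x) J)"

definition rate_function :: "(real \<Rightarrow> ereal) \<Rightarrow> bool" where
  "rate_function J \<longleftrightarrow> (\<forall>x. 0 \<le> J x) \<and> lower_semicontinuous J"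

definition good_rate_function :: "(real \<Rightarrow> ereal) \<Rightarrow> bool" where
  "good_rate_function J \<longleftrightarrow> rate_function J \<and> (\<forall>b::real. compact (J -` {0..ereal b}))"

text \<open>Large deviation principle with speed \<open>n\<close> for \<open>V 1, V 2, \<dots>\<close>. The infimum over the empty
  set is \<open>\<infinity>\<close>.\<close>

definition satisfies_LDP ::
  "'a measure \<Rightarrow> (nat \<Rightarrow> 'a \<Rightarrow> real) \<Rightarrow> (real \<Rightarrow> ereal) \<Rightarrow> bool" where
  "satisfies_LDP M V J \<longleftrightarrow>
     (\<forall>n\<ge>1. V n \<in> borel_measurable M) \<and>
     rate_function J \<and>
     (\<forall>F. closed F \<longrightarrow>
        limsup (\<lambda>n. ereal (1 / real n) * log_prob (measure M {\<omega> \<in> space M. V n \<omega> \<in> F}))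
          \<le> - (INF x\<in>F. J x)) \<and>
     (\<forall>G. open G \<longrightarrow>
        - (INF x\<in>G. J x)
          \<le> liminf (\<lambda>n. ereal (1 / real n) * log_prob (measure M {\<omega> \<in> space M. V n \<omega> \<in> G})))"

end

theory Submission
  imports Defs "HOL-Real_Asymp.Real_Asymp"
begin

text \<open>
  Solving the recursion gives
  \<open>X 1 + \<dots> + X n = g n * X 1 + g (n - 1) * \<epsilon> 2 + \<dots> + g 1 * \<epsilon> n\<close> with
  \<open>g m = 1 + \<theta> + \<dots> + \<theta> ^ (m - 1)\<close>: an innovation that enters at time \<open>j\<close> is felt, damped by a
  power of \<open>\<theta>\<close>, at all later times up to \<open>n\<close>. The summands are independent and normal, so the
  sample mean is exactly \<open>N(0, (\<sigma> n)\<^sup>2)\<close> (\<open>sample_mean_distributed\<close>). Since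
  \<open>g m\<close> tends to \<open>1 / (1 - \<theta>)\<close> geometrically fast, the variance of the sum differs from
  \<open>n / (1 - \<theta>)\<^sup>2\<close> by a bounded amount; hence
  \<open>n * (\<sigma> n)\<^sup>2\<close> tends to \<open>v = 1 / (1 - \<theta>)\<^sup>2\<close> (\<open>partial_sum_variance_asymp\<close>).

  What remains is a statement about single Gaussian laws: if \<open>V n\<close> is \<open>N(0, (\<sigma> n)\<^sup>2)\<close> and
  \<open>n * (\<sigma> n)\<^sup>2\<close> tends to \<open>v > 0\<close>, then the large deviation principle holds with rate
  \<open>c\<^sup>2 / (2 * v)\<close> (\<open>centred_normal_satisfies_LDP\<close>), whatever the joint law of the \<open>V n\<close> is.
  A closed set lies outside the open interval around 0 that reaches to its point of least
  modulus, so a Gaussian tail bound settles the upper estimate. For the lower estimate, an open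
  set contains, around each of its points, the interval of radius \<open>1 / n\<close> for large \<open>n\<close>. The
  length of that interval costs only a polynomial factor, and on it the density is at least its
  value at \<open>\<bar>x\<bar> + 1 / n\<close>.
\<close>

section \<open>Large deviations of centred Gaussian variables\<close>

text \<open>
  If \<open>0 \<le> d \<le> \<bar>x\<bar>\<close> then \<open>x\<^sup>2 \<ge> d\<^sup>2 + (\<bar>x\<bar> - d)\<^sup>2\<close>. Comparing with shifted
  densities rather than estimating the tail integral makes the Chernoff bound below immediate,
  because each shifted density integrates to one.
\<close>

lemma normal_density_tail_split:
  assumes "0 < \<sigma>" "0 \<le> d" "d \<le> \<bar>x\<bar>"
  shows "normal_density 0 \<sigma> x
    \<le> exp (- d\<^sup>2 / (2 * \<sigma>\<^sup>2)) * (normal_density d \<sigma> x + normal_density (- d) \<sigma> x)"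
proof -
  have key: "normal_density 0 \<sigma> x \<le> exp (- d\<^sup>2 / (2 * \<sigma>\<^sup>2)) * normal_density e \<sigma> x"
    if "e * e = d * d" "e * e \<le> e * x" for e
  proof -
    have "d\<^sup>2 + (x - e)\<^sup>2 \<le> x\<^sup>2"
      using that by (simp add: power2_eq_square algebra_simps)
    then have "(d\<^sup>2 + (x - e)\<^sup>2) / (2 * \<sigma>\<^sup>2) \<le> x\<^sup>2 / (2 * \<sigma>\<^sup>2)"
      using assms(1) by (intro divide_right_mono) auto
    then have "- (x\<^sup>2) / (2 * \<sigma>\<^sup>2) \<le> - d\<^sup>2 / (2 * \<sigma>\<^sup>2) + - ((x - e)\<^sup>2) / (2 * \<sigma>\<^sup>2)"
      by (simp add: add_divide_distrib)
    then have "exp (- (x\<^sup>2) / (2 * \<sigma>\<^sup>2))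
        \<le> exp (- d\<^sup>2 / (2 * \<sigma>\<^sup>2)) * exp (- ((x - e)\<^sup>2) / (2 * \<sigma>\<^sup>2))"
      by (simp add: exp_add[symmetric])
    then show ?thesis
      using assms(1) by (simp add: normal_density_def divide_right_mono)
  qed
  show ?thesis
  proof (cases "0 \<le> x")
    case True
    have "normal_density 0 \<sigma> x \<le> exp (- d\<^sup>2 / (2 * \<sigma>\<^sup>2)) * normal_density d \<sigma> x"
      using assms True by (intro key mult_left_mono) auto
    also have "\<dots> \<le> exp (- d\<^sup>2 / (2 * \<sigma>\<^sup>2)) * (normal_density d \<sigma> x + normal_density (- d) \<sigma> x)"
      by (intro mult_left_mono) auto
    finally show ?thesis .
  next
    case False
    have "normal_density 0 \<sigma> x \<le> exp (- d\<^sup>2 / (2 * \<sigma>\<^sup>2)) * normal_density (- d) \<sigma> x"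
      using assms False mult_left_mono[of d "- x" d] by (intro key) auto
    also have "\<dots> \<le> exp (- d\<^sup>2 / (2 * \<sigma>\<^sup>2)) * (normal_density d \<sigma> x + normal_density (- d) \<sigma> x)"
      by (intro mult_left_mono) auto
    finally show ?thesis .
  qed
qed

lemma (in prob_space) prob_centred_normal_le:
  assumes V: "distributed M lborel V (normal_density 0 \<sigma>)" and \<sigma>: "0 < \<sigma>"
    and A: "A \<in> sets borel" and d: "0 \<le> d" "\<And>x. x \<in> A \<Longrightarrow> d \<le> \<bar>x\<bar>"
  shows "prob {\<omega> \<in> space M. V \<omega> \<in> A} \<le> 2 * exp (- d\<^sup>2 / (2 * \<sigma>\<^sup>2))"
proof -
  let ?g = "\<lambda>x. exp (- d\<^sup>2 / (2 * \<sigma>\<^sup>2)) * (normal_density d \<sigma> x + normal_density (- d) \<sigma> x)"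
  have "emeasure M {\<omega> \<in> space M. V \<omega> \<in> A} = emeasure M (V -` A \<inter> space M)"
    by (intro arg_cong[where f="emeasure M"]) auto
  also have "\<dots> = (\<integral>\<^sup>+x. ennreal (normal_density 0 \<sigma> x) * indicator A x \<partial>lborel)"
    using distributed_emeasure[OF V, of A] A by simp
  also have "\<dots> \<le> (\<integral>\<^sup>+x. ennreal (?g x) \<partial>lborel)"
  proof (intro nn_integral_mono)
    fix x
    show "ennreal (normal_density 0 \<sigma> x) * indicator A x \<le> ennreal (?g x)"
      using normal_density_tail_split[OF \<sigma> d(1) d(2), of x]
      by (auto split: split_indicator intro: ennreal_leI)
  qed
  also have "\<dots> = ennreal (\<integral>x. ?g x \<partial>lborel)"
    using \<sigma> by (intro nn_integral_eq_integral) auto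
  also have "(\<integral>x. ?g x \<partial>lborel) = 2 * exp (- d\<^sup>2 / (2 * \<sigma>\<^sup>2))"
    using \<sigma> by simp
  finally show ?thesis
    by (simp add: emeasure_eq_measure)
qed

lemma (in prob_space) prob_centred_normal_ge:
  assumes V: "distributed M lborel V (normal_density 0 \<sigma>)" and \<sigma>: "0 < \<sigma>"
    and A: "A \<in> sets borel" and r: "0 < r" "{x - r..x + r} \<subseteq> A"
  shows "2 * r * (1 / sqrt (2 * pi * \<sigma>\<^sup>2) * exp (- (\<bar>x\<bar> + r)\<^sup>2 / (2 * \<sigma>\<^sup>2)))
    \<le> prob {\<omega> \<in> space M. V \<omega> \<in> A}"
proof -
  let ?c = "1 / sqrt (2 * pi * \<sigma>\<^sup>2) * exp (- (\<bar>x\<bar> + r)\<^sup>2 / (2 * \<sigma>\<^sup>2))"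
  have lower: "?c \<le> normal_density 0 \<sigma> y" if "y \<in> {x - r..x + r}" for y
  proof -
    have "y\<^sup>2 \<le> (\<bar>x\<bar> + r)\<^sup>2"
      using that r by (intro iffD1[OF abs_le_square_iff]) auto
    then show ?thesis
      using \<sigma> by (auto simp: normal_density_def intro!: divide_right_mono)
  qed
  have "ennreal (2 * r * ?c) = (\<integral>\<^sup>+y. ennreal ?c * indicator {x - r..x + r} y \<partial>lborel)"
  proof -
    have "(\<integral>\<^sup>+y. ennreal ?c * indicator {x - r..x + r} y \<partial>lborel) = ennreal ?c * ennreal (2 * r)"
      using r(1) by (subst nn_integral_cmult_indicator) auto
    then show ?thesis
      using r(1) by (simp add: ennreal_mult''[symmetric] mult.commute)
  qed
  also have "\<dots> \<le> (\<integral>\<^sup>+y. ennreal (normal_density 0 \<sigma> y) * indicator A y \<partial>lborel)"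
  proof (intro nn_integral_mono)
    fix y
    show "ennreal ?c * indicator {x - r..x + r} y
        \<le> ennreal (normal_density 0 \<sigma> y) * indicator A y"
      using lower[of y] r(2) by (auto split: split_indicator intro: ennreal_leI)
  qed
  also have "\<dots> = emeasure M (V -` A \<inter> space M)"
    using distributed_emeasure[OF V, of A] A by simp
  also have "\<dots> = emeasure M {\<omega> \<in> space M. V \<omega> \<in> A}"
    by (intro arg_cong[where f="emeasure M"]) auto
  finally show ?thesis
    by (simp add: emeasure_eq_measure)
qed

lemma good_rate_function_quadratic:
  assumes "0 < a"
  shows "good_rate_function (\<lambda>c. ereal (c\<^sup>2 * a))"
proof -
  have "lower_semicontinuous (\<lambda>c. ereal (c\<^sup>2 * a))"
    unfolding lower_semicontinuous_def
  proof
    fix x :: real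
    have "((\<lambda>c. ereal (c\<^sup>2 * a)) \<longlongrightarrow> ereal (x\<^sup>2 * a)) (at x)"
      by (intro tendsto_intros)
    from lim_imp_Liminf[OF _ this]
    show "ereal (x\<^sup>2 * a) \<le> Liminf (at x) (\<lambda>c. ereal (c\<^sup>2 * a))"
      by simp
  qed
  moreover have "compact ((\<lambda>c. ereal (c\<^sup>2 * a)) -` {0..ereal b})" for b
  proof -
    have eq: "(\<lambda>c. ereal (c\<^sup>2 * a)) -` {0..ereal b} = {c. c\<^sup>2 * a \<le> b}"
      using assms by (auto simp: zero_ereal_def)
    have "closed {c. c\<^sup>2 * a \<le> b}"
      by (intro closed_Collect_le continuous_intros)
    moreover have "bounded {c. c\<^sup>2 * a \<le> b}"
    proof (rule boundedI)
      fix c assume "c \<in> {c. c\<^sup>2 * a \<le> b}"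
      then have "\<bar>c\<bar>\<^sup>2 \<le> b / a"
        using assms by (simp add: field_simps)
      then show "norm c \<le> sqrt (b / a)"
        by (simp add: real_le_rsqrt)
    qed
    ultimately show ?thesis
      unfolding eq by (simp add: compact_eq_bounded_closed)
  qed
  ultimately show ?thesis
    using assms by (auto simp: good_rate_function_def rate_function_def)
qed

lemma ereal_scaled_log_prob_le:
  assumes "0 \<le> p" "p \<le> q" "0 < q" "1 \<le> n"
  shows "ereal (1 / real n) * log_prob p \<le> ereal (ln q / real n)"
proof (cases "p = 0")
  case False
  then have "ln p \<le> ln q" using assms by simp
  then show ?thesis
    using False by (simp add: log_prob_def divide_right_mono)
qed (use assms in \<open>simp add: log_prob_def\<close>)

lemma ereal_scaled_log_prob_ge:
  assumes "q \<le> p" "0 < q" "1 \<le> n"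
  shows "ereal (ln q / real n) \<le> ereal (1 / real n) * log_prob p"
  using assms by (simp add: log_prob_def divide_right_mono)

text \<open>
  Both estimates are squeezed by explicit real sequences converging to \<open>- x\<^sup>2 / (2 * v)\<close>, where
  \<open>x\<close> is the point of least modulus of the closed set, or an arbitrary point of the open one.
\<close>

lemma (in prob_space) centred_normal_satisfies_LDP:
  assumes V: "\<And>n. 1 \<le> n \<Longrightarrow> distributed M lborel (V n) (normal_density 0 (\<sigma> n))"
    and \<sigma>: "\<And>n. 1 \<le> n \<Longrightarrow> 0 < \<sigma> n"
    and lim: "(\<lambda>n. real n * (\<sigma> n)\<^sup>2) \<longlonglongrightarrow> v" and v: "0 < v"
  shows "satisfies_LDP M V (\<lambda>c. ereal (c\<^sup>2 * (1 / (2 * v))))"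
  unfolding satisfies_LDP_def
proof (intro conjI allI impI)
  fix n :: nat assume "1 \<le> n"
  from V[OF this] show "V n \<in> borel_measurable M"
    using distributed_measurable by force
next
  show "rate_function (\<lambda>c. ereal (c\<^sup>2 * (1 / (2 * v))))"
    using good_rate_function_quadratic[of "1 / (2 * v)"] v
    by (simp add: good_rate_function_def)
next
  fix F :: "real set" assume F: "closed F"
  let ?L = "\<lambda>n. ereal (1 / real n) * log_prob (prob {\<omega> \<in> space M. V n \<omega> \<in> F})"
  show "limsup ?L \<le> - (INF x\<in>F. ereal (x\<^sup>2 * (1 / (2 * v))))"
  proof (cases "F = {}")
    case True
    \<comment> \<open>The product is 0, not \<open>- \<infinity>\<close>, at \<open>n = 0\<close>.\<close>
    have "eventually (\<lambda>n. ?L n = - \<infinity>) sequentially"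
      using eventually_ge_at_top[of 1]
      by eventually_elim (simp add: True log_prob_def)
    then have "limsup ?L = limsup (\<lambda>n. - \<infinity> :: ereal)"
      by (rule Limsup_eq)
    also have "\<dots> = - \<infinity>" by (simp add: Limsup_const)
    finally show ?thesis by simp
  next
    case False
    then obtain x where x: "x \<in> F" "\<And>y. y \<in> F \<Longrightarrow> \<bar>x\<bar> \<le> \<bar>y\<bar>"
      using distance_attains_inf[OF F, of 0] by (auto simp: dist_real_def)
    let ?u = "\<lambda>n. ln 2 / real n - x\<^sup>2 / (2 * (real n * (\<sigma> n)\<^sup>2))"
    have "(\<lambda>n. ln 2 / real n) \<longlonglongrightarrow> 0" by real_asymp
    then have "?u \<longlonglongrightarrow> 0 - x\<^sup>2 / (2 * v)"
      by (rule tendsto_diff) (use v in \<open>intro tendsto_intros lim; simp\<close>)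
    then have u: "(\<lambda>n. ereal (?u n)) \<longlonglongrightarrow> ereal (- (x\<^sup>2 / (2 * v)))" by simp
    have "eventually (\<lambda>n. ?L n \<le> ereal (?u n)) sequentially"
      using eventually_ge_at_top[of 1]
    proof eventually_elim
      case (elim n)
      have "?L n \<le> ereal (ln (2 * exp (- \<bar>x\<bar>\<^sup>2 / (2 * (\<sigma> n)\<^sup>2))) / real n)"
        using elim x F
        by (intro ereal_scaled_log_prob_le prob_centred_normal_le V \<sigma>) auto
      also have "\<dots> = ereal (?u n)"
        using elim by (simp add: ln_mult add_divide_distrib diff_divide_distrib mult.commute)
      finally show ?case .
    qed
    then have "limsup ?L \<le> limsup (\<lambda>n. ereal (?u n))" by (rule Limsup_mono)
    also have "\<dots> = ereal (- (x\<^sup>2 / (2 * v)))"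
      using u by (intro lim_imp_Limsup) auto
    also have "\<dots> = - ereal (x\<^sup>2 * (1 / (2 * v)))" by simp
    also have "\<dots> \<le> - (INF x\<in>F. ereal (x\<^sup>2 * (1 / (2 * v))))"
      unfolding ereal_minus_le_minus by (rule INF_lower[OF x(1)])
    finally show ?thesis .
  qed
next
  fix G :: "real set" assume G: "open G"
  let ?L = "\<lambda>n. ereal (1 / real n) * log_prob (prob {\<omega> \<in> space M. V n \<omega> \<in> G})"
  have "- liminf ?L \<le> (INF x\<in>G. ereal (x\<^sup>2 * (1 / (2 * v))))"
  proof (rule INF_greatest)
    fix x assume "x \<in> G"
    then obtain e where e: "0 < e" "cball x e \<subseteq> G"
      using G open_contains_cball by blast
    let ?u = "\<lambda>n. ln (2 / sqrt (2 * pi)) / real n - ln (real n) / real n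
        - (\<bar>x\<bar> + 1 / real n)\<^sup>2 / (2 * (real n * (\<sigma> n)\<^sup>2))"
    have "(\<lambda>n. ln (2 / sqrt (2 * pi)) / real n - ln (real n) / real n) \<longlonglongrightarrow> 0"
      by real_asymp
    moreover have "(\<lambda>n. \<bar>x\<bar> + 1 / real n) \<longlonglongrightarrow> \<bar>x\<bar>" by real_asymp
    ultimately have "?u \<longlonglongrightarrow> 0 - \<bar>x\<bar>\<^sup>2 / (2 * v)"
      using v by (intro tendsto_diff tendsto_divide tendsto_power tendsto_mult tendsto_const lim) auto
    then have u: "(\<lambda>n. ereal (?u n)) \<longlonglongrightarrow> ereal (- (x\<^sup>2 / (2 * v)))" by simp
    \<comment> \<open>The variance tends to zero, so eventually the factor \<open>1 / \<sigma> n\<close> of the density is at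
      least one and can be dropped.\<close>
    have "(\<lambda>n. real n * (\<sigma> n)\<^sup>2 * (1 / real n)) \<longlonglongrightarrow> v * 0"
      by (intro tendsto_mult lim lim_1_over_n)
    then have "eventually (\<lambda>n. real n * (\<sigma> n)\<^sup>2 * (1 / real n) < 1) sequentially"
      by (intro order_tendstoD) auto
    moreover have "eventually (\<lambda>n. 1 / real n < e) sequentially"
      using e by (intro order_tendstoD[OF lim_1_over_n]) auto
    ultimately have "eventually (\<lambda>n. ereal (?u n) \<le> ?L n) sequentially"
      using eventually_ge_at_top[of 1]
    proof eventually_elim
      case (elim n)
      have "{x - 1 / real n..x + 1 / real n} \<subseteq> cball x e"
        using elim(2) by (auto simp: dist_real_def)
      with e have sub: "{x - 1 / real n..x + 1 / real n} \<subseteq> G" by blast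
      let ?E = "exp (- (\<bar>x\<bar> + 1 / real n)\<^sup>2 / (2 * (\<sigma> n)\<^sup>2))"
      have s: "0 < \<sigma> n" "(\<sigma> n)\<^sup>2 \<le> 1" using elim \<sigma> by auto
      have "sqrt (2 * pi * (\<sigma> n)\<^sup>2) \<le> sqrt (2 * pi)"
        using s by (simp add: mult_left_le)
      then have "1 / sqrt (2 * pi) \<le> 1 / sqrt (2 * pi * (\<sigma> n)\<^sup>2)"
        using s by (intro divide_left_mono) auto
      then have "2 * (1 / real n) * (1 / sqrt (2 * pi) * ?E)
          \<le> 2 * (1 / real n) * (1 / sqrt (2 * pi * (\<sigma> n)\<^sup>2) * ?E)"
        by (intro mult_left_mono mult_right_mono) auto
      also have "\<dots> \<le> prob {\<omega> \<in> space M. V n \<omega> \<in> G}"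
        using elim G sub s by (intro prob_centred_normal_ge V) auto
      finally have "ereal (ln (2 * (1 / real n) * (1 / sqrt (2 * pi) * ?E)) / real n) \<le> ?L n"
        using elim by (intro ereal_scaled_log_prob_ge) auto
      moreover have "ln (2 * (1 / real n) * (1 / sqrt (2 * pi) * ?E)) / real n = ?u n"
      proof -
        have "ln (2 * (1 / real n) * (1 / sqrt (2 * pi) * ?E))
            = ln (2 / sqrt (2 * pi) / real n * ?E)" by (simp add: field_simps)
        also have "\<dots> = ln (2 / sqrt (2 * pi)) - ln (real n) - (\<bar>x\<bar> + 1 / real n)\<^sup>2 / (2 * (\<sigma> n)\<^sup>2)"
          using elim by (subst ln_mult; (subst ln_div)?) auto
        finally show ?thesis
          by (simp add: diff_divide_distrib mult.commute mult.left_commute)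
      qed
      ultimately show ?case by simp
    qed
    then have "liminf (\<lambda>n. ereal (?u n)) \<le> liminf ?L" by (rule Liminf_mono)
    moreover have "liminf (\<lambda>n. ereal (?u n)) = ereal (- (x\<^sup>2 / (2 * v)))"
      using u by (intro lim_imp_Liminf) auto
    ultimately have "- ereal (x\<^sup>2 / (2 * v)) \<le> liminf ?L" by simp
    then show "- liminf ?L \<le> ereal (x\<^sup>2 * (1 / (2 * v)))"
      by (subst ereal_uminus_le_reorder) simp
  qed
  then show "- (INF x\<in>G. ereal (x\<^sup>2 * (1 / (2 * v)))) \<le> liminf ?L"
    by (subst ereal_uminus_le_reorder)
qed

section \<open>The law of the sample mean\<close>

lemma vimage_algebra_comp_subset:
  assumes f: "f \<in> \<Omega> \<rightarrow> space N" and F: "F \<in> measurable N S"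
  shows "sigma_sets \<Omega> {(F \<circ> f) -` A \<inter> \<Omega> | A. A \<in> sets S} \<subseteq> sets (vimage_algebra \<Omega> f N)"
proof -
  have "F \<circ> f \<in> measurable (vimage_algebra \<Omega> f N) S"
    by (rule measurable_comp[OF measurable_vimage_algebra1[OF f] F])
  then have "{(F \<circ> f) -` A \<inter> \<Omega> | A. A \<in> sets S} \<subseteq> sets (vimage_algebra \<Omega> f N)"
    by (auto dest: measurable_sets)
  then show ?thesis
    using sets.sigma_sets_subset[of _ "vimage_algebra \<Omega> f N"] by simp
qed

text \<open>
  The hypothesis speaks of the generated \<open>\<sigma>\<close>-algebras, so \<open>f\<close> and \<open>g\<close> may take values in
  different types, such as a number and a sequence; \<open>F\<close> and \<open>G\<close> bring them to a common type.
\<close>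

lemma (in prob_space) indep_var_comp_of_indep_vimage_algebras:
  assumes f: "f \<in> measurable M N" and g: "g \<in> measurable M K"
    and F: "F \<in> measurable N S" and G: "G \<in> measurable K T"
    and indep: "indep_set (sets (vimage_algebra (space M) f N)) (sets (vimage_algebra (space M) g K))"
  shows "indep_var S (F \<circ> f) T (G \<circ> g)"
proof -
  have fg: "f \<in> space M \<rightarrow> space N" "g \<in> space M \<rightarrow> space K"
    using f g by (auto dest: measurable_space)
  note sub = vimage_algebra_comp_subset[OF fg(1) F] vimage_algebra_comp_subset[OF fg(2) G]
  have "indep_set (sigma_sets (space M) {(F \<circ> f) -` A \<inter> space M | A. A \<in> sets S})
      (sigma_sets (space M) {(G \<circ> g) -` A \<inter> space M | A. A \<in> sets T})"
    using indep unfolding indep_set_def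
    by (rule indep_sets_mono_sets) (use sub in \<open>auto split: bool.split\<close>)
  then show ?thesis
    unfolding indep_var_eq using measurable_comp[OF f F] measurable_comp[OF g G] by blast
qed

text \<open>
  The total contribution of a unit shock to the \<open>m\<close> observations from its arrival on.
\<close>

definition geometric_weight :: "real \<Rightarrow> nat \<Rightarrow> real" where
  "geometric_weight \<theta> m = (\<Sum>i<m. \<theta> ^ i)"

lemma geometric_weight_eq: "\<theta> \<noteq> 1 \<Longrightarrow> geometric_weight \<theta> m = (1 - \<theta> ^ m) / (1 - \<theta>)"
  by (simp add: geometric_weight_def sum_gp_strict)

lemma geometric_weight_Suc: "geometric_weight \<theta> (Suc m) = geometric_weight \<theta> m + \<theta> ^ m"
  by (simp add: geometric_weight_def)

lemma geometric_weight_pos: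
  assumes "\<bar>\<theta>\<bar> < 1" "1 \<le> m"
  shows "0 < geometric_weight \<theta> m"
proof -
  have "\<bar>\<theta> ^ m\<bar> < 1"
    using assms by (simp add: power_abs power_less_one_iff)
  then have "\<theta> ^ m < 1" by linarith
  then show ?thesis
    using assms by (subst geometric_weight_eq) auto
qed

lemma geometric_weight_tendsto:
  assumes "\<bar>\<theta>\<bar> < 1"
  shows "geometric_weight \<theta> \<longlonglongrightarrow> 1 / (1 - \<theta>)"
  using geometric_sums[of \<theta>] assms by (simp add: sums_def geometric_weight_def[abs_def])

text \<open>
  Expanding the square \<open>(1 - \<theta> ^ m)\<^sup>2\<close> leaves two geometric sums as corrections to \<open>n\<close>; they
  stay bounded, so the growth of the variance is linear with slope \<open>1 / (1 - \<theta>)\<^sup>2\<close>.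
\<close>

lemma sum_geometric_weight_squared:
  assumes "\<bar>\<theta>\<bar> < 1"
  shows "(\<Sum>m<n. (geometric_weight \<theta> m)\<^sup>2)
    = (real n - 2 * geometric_weight \<theta> n + geometric_weight (\<theta>\<^sup>2) n) / (1 - \<theta>)\<^sup>2"
proof -
  have "(geometric_weight \<theta> m)\<^sup>2 = (1 - 2 * \<theta> ^ m + (\<theta>\<^sup>2) ^ m) / (1 - \<theta>)\<^sup>2" for m
    using assms
    by (subst geometric_weight_eq)
       (auto simp: power_divide power2_diff power_mult[symmetric] mult.commute)
  then show ?thesis
    by (simp add: sum_divide_distrib[symmetric] sum.distrib sum_subtractf
        sum_distrib_left[symmetric] geometric_weight_def)
qed

text \<open>
  The first summand is the share of \<open>X 1\<close>, which has variance \<open>1 / (1 - \<theta>\<^sup>2)\<close>.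
\<close>

definition partial_sum_variance :: "real \<Rightarrow> nat \<Rightarrow> real" where
  "partial_sum_variance \<theta> n =
    (geometric_weight \<theta> n)\<^sup>2 / (1 - \<theta>\<^sup>2) + (\<Sum>j=2..n. (geometric_weight \<theta> (Suc n - j))\<^sup>2)"

lemma partial_sum_variance_asymp:
  assumes "\<bar>\<theta>\<bar> < 1"
  shows "(\<lambda>n. partial_sum_variance \<theta> n / real n) \<longlonglongrightarrow> 1 / (1 - \<theta>)\<^sup>2"
proof -
  have reindex: "(\<Sum>j=2..n. (geometric_weight \<theta> (Suc n - j))\<^sup>2) = (\<Sum>m<n. (geometric_weight \<theta> m)\<^sup>2)"
    for n
  proof -
    have "(\<Sum>j=2..n. (geometric_weight \<theta> (Suc n - j))\<^sup>2) = (\<Sum>m=1..<n. (geometric_weight \<theta> m)\<^sup>2)"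
      by (rule sum.reindex_bij_witness[of _ "\<lambda>m. Suc n - m" "\<lambda>j. Suc n - j"]) auto
    also have "\<dots> = (\<Sum>m<n. (geometric_weight \<theta> m)\<^sup>2)"
      by (intro sum.mono_neutral_left) (auto simp: geometric_weight_def not_le)
    finally show ?thesis .
  qed
  have sq: "\<bar>\<theta>\<^sup>2\<bar> < 1" using assms by (simp add: abs_square_less_1)
  let ?w = "\<lambda>t n. geometric_weight t n * (1 / real n)"
  have null: "?w t \<longlonglongrightarrow> 0" if "\<bar>t\<bar> < 1" for t
    using tendsto_mult[OF geometric_weight_tendsto[OF that] lim_1_over_n] by simp
  have "(\<lambda>n. geometric_weight \<theta> n * ?w \<theta> n / (1 - \<theta>\<^sup>2)
      + (1 - 2 * ?w \<theta> n + ?w (\<theta>\<^sup>2) n) / (1 - \<theta>)\<^sup>2)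
      \<longlonglongrightarrow> 1 / (1 - \<theta>) * 0 / (1 - \<theta>\<^sup>2) + (1 - 2 * 0 + 0) / (1 - \<theta>)\<^sup>2"
    by (intro tendsto_intros null geometric_weight_tendsto assms sq)
       (use assms sq in auto)
  moreover have "eventually (\<lambda>n. geometric_weight \<theta> n * ?w \<theta> n / (1 - \<theta>\<^sup>2)
      + (1 - 2 * ?w \<theta> n + ?w (\<theta>\<^sup>2) n) / (1 - \<theta>)\<^sup>2 = partial_sum_variance \<theta> n / real n) sequentially"
    using eventually_ge_at_top[of 1]
  proof eventually_elim
    case (elim n)
    then have "1 - 2 * ?w \<theta> n + ?w (\<theta>\<^sup>2) n
        = (real n - 2 * geometric_weight \<theta> n + geometric_weight (\<theta>\<^sup>2) n) / real n"
      by (simp add: add_divide_distrib diff_divide_distrib)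
    then show ?case
      unfolding partial_sum_variance_def reindex sum_geometric_weight_squared[OF assms]
      by (simp add: add_divide_distrib power2_eq_square mult.commute)
  qed
  ultimately show ?thesis
    by (simp add: tendsto_cong)
qed

context stationary_gaussian_AR1
begin

lemma one_minus_theta_sq_pos: "0 < 1 - \<theta>\<^sup>2"
  using abs_theta_less_1 abs_square_less_1[of \<theta>] by simp

text \<open>
  The \<open>X k\<close> are correlated unless \<open>\<theta> = 0\<close>, whereas the initial value and the innovations are
  independent; the law of the sum can be read off once it is expressed through them.
\<close>

lemma X_closed_form:
  assumes "1 \<le> n" "\<omega> \<in> space M"
  shows "X n \<omega> = \<theta> ^ (n - 1) * X 1 \<omega> + (\<Sum>j=2..n. \<theta> ^ (n - j) * \<epsilon> j \<omega>)"
  using assms(1)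
proof (induction n rule: dec_induct)
  case (step n)
  have "\<theta> * (\<Sum>j=2..n. \<theta> ^ (n - j) * \<epsilon> j \<omega>) = (\<Sum>j=2..n. \<theta> ^ (Suc n - j) * \<epsilon> j \<omega>)"
    by (auto simp: sum_distrib_left Suc_diff_le intro!: sum.cong)
  moreover have "\<theta> * \<theta> ^ (n - 1) = \<theta> ^ n"
    using step(1) by (cases n) auto
  ultimately show ?case
    using AR1_recursion[of n \<omega>] step assms(2) by (simp add: algebra_simps)
qed simp

lemma partial_sum_eq:
  assumes "\<omega> \<in> space M"
  shows "(\<Sum>k=1..n. X k \<omega>)
    = geometric_weight \<theta> n * X 1 \<omega> + (\<Sum>j=2..n. geometric_weight \<theta> (Suc n - j) * \<epsilon> j \<omega>)"
proof (induction n)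
  case 0
  then show ?case by (simp add: geometric_weight_def)
next
  case (Suc n)
  have split: "(\<Sum>j=2..Suc n. g j) = (\<Sum>j=2..n. g j) + (if n = 0 then 0 else g (Suc n))"
    for g :: "nat \<Rightarrow> real" by (cases n) auto
  have "(\<Sum>j=2..n. geometric_weight \<theta> (Suc (Suc n) - j) * \<epsilon> j \<omega>)
      = (\<Sum>j=2..n. geometric_weight \<theta> (Suc n - j) * \<epsilon> j \<omega>) + (\<Sum>j=2..n. \<theta> ^ (Suc n - j) * \<epsilon> j \<omega>)"
    unfolding sum.distrib[symmetric]
    by (intro sum.cong) (auto simp: Suc_diff_le geometric_weight_Suc algebra_simps)
  moreover have "geometric_weight \<theta> (Suc 0) = 1" by (simp add: geometric_weight_def)
  ultimately show ?case
    using Suc.IH X_closed_form[of "Suc n" \<omega>] assms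
    by (simp add: split geometric_weight_Suc algebra_simps)
qed

text \<open>
  The innovation part is normal by independence of the innovations, and is a measurable function of
  the innovation sequence, hence independent of \<open>X 1\<close>.
\<close>

lemma partial_sum_distributed:
  assumes "1 \<le> n"
  shows "distributed M lborel
    (\<lambda>\<omega>. geometric_weight \<theta> n * X 1 \<omega> + (\<Sum>j=2..n. geometric_weight \<theta> (Suc n - j) * \<epsilon> j \<omega>))
    (normal_density 0 (sqrt (partial_sum_variance \<theta> n)))"
proof -
  let ?c = "geometric_weight \<theta>"
  let ?s = "sqrt (1 / (1 - \<theta>\<^sup>2))"
  define N where "N = (\<lambda>\<omega>. \<Sum>j=2..n. ?c (Suc n - j) * \<epsilon> j \<omega>)"
  have c_pos: "0 < ?c m" if "1 \<le> m" for m
    using geometric_weight_pos[OF abs_theta_less_1 that] .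
  have s_pos: "0 < ?s" using one_minus_theta_sq_pos by simp
  have initial: "distributed M lborel (\<lambda>\<omega>. ?c n * X 1 \<omega>) (normal_density 0 (?c n * ?s))"
    using normal_density_affine[OF initial_normal s_pos, of "?c n" 0] c_pos[OF assms] by simp
  have initial_var: "(?c n * ?s)\<^sup>2 = (?c n)\<^sup>2 / (1 - \<theta>\<^sup>2)"
    using one_minus_theta_sq_pos by (simp add: power_mult_distrib power_divide)
  show ?thesis
  proof (cases "n = 1")
    \<comment> \<open>There are no innovations yet, and the zero variable has no normal density.\<close>
    case True
    then have "sqrt (partial_sum_variance \<theta> n) = sqrt ((?c n * ?s)\<^sup>2)"
      using initial_var by (simp add: partial_sum_variance_def)
    also have "\<dots> = ?c n * ?s"
      using c_pos[OF assms] s_pos by (simp only: real_sqrt_abs abs_of_pos mult_pos_pos)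
    finally show ?thesis
      using initial True by simp
  next
    case False
    with assms have n: "2 \<le> n" by simp
    have weight_pos: "0 < ?c (Suc n - j)" if "j \<in> {2..n}" for j
      using that by (intro c_pos) auto
    have "indep_vars (\<lambda>_. borel) (\<lambda>j \<omega>. ?c (Suc n - j) * \<epsilon> j \<omega>) {2..n}"
      by (rule indep_vars_compose2[OF indep_vars_subset[OF innovations_indep]]) auto
    moreover have "distributed M lborel (\<lambda>\<omega>. ?c (Suc n - j) * \<epsilon> j \<omega>)
        (normal_density 0 (?c (Suc n - j)))" if "j \<in> {2..n}" for j
    proof -
      have "2 \<le> j" "0 < ?c (Suc n - j)" using that weight_pos by auto
      then show ?thesis
        using normal_density_affine[OF innovations_normal, of j "?c (Suc n - j)" 0] by simp
    qed
    ultimately have noise: "distributed M lborel N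
        (normal_density 0 (sqrt (\<Sum>j=2..n. (?c (Suc n - j))\<^sup>2)))"
      using sum_indep_normal[of "{2..n}" "\<lambda>j \<omega>. ?c (Suc n - j) * \<epsilon> j \<omega>"
          "\<lambda>j. ?c (Suc n - j)" "\<lambda>_. 0"] n weight_pos
      by (simp add: N_def Suc_le_eq)
    have noise_pos: "0 < (\<Sum>j=2..n. (?c (Suc n - j))\<^sup>2)"
      using n by (intro sum_pos zero_less_power weight_pos) auto
    have X1: "X 1 \<in> borel_measurable M"
      using distributed_measurable[OF initial_normal] by simp
    have \<epsilon>: "\<epsilon> j \<in> borel_measurable M" if "2 \<le> j" for j
      using distributed_measurable[OF innovations_normal[OF that]] by simp
    have "indep_var borel ((\<lambda>x. ?c n * x) \<circ> X 1) borel
        ((\<lambda>e. \<Sum>j=2..n. ?c (Suc n - j) * e j) \<circ> (\<lambda>\<omega>. \<lambda>n\<in>{2..}. \<epsilon> n \<omega>))"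
    proof (rule indep_var_comp_of_indep_vimage_algebras[OF X1 _ _ _ initial_indep])
      show "(\<lambda>\<omega>. \<lambda>n\<in>{2..}. \<epsilon> n \<omega>) \<in> measurable M (\<Pi>\<^sub>M n\<in>{2..}. borel)"
        using \<epsilon> by (intro measurable_restrict) auto
      show "(\<lambda>e. \<Sum>j=2..n. ?c (Suc n - j) * e j) \<in> borel_measurable (\<Pi>\<^sub>M n\<in>{2..}. borel)"
        by (intro borel_measurable_sum borel_measurable_times borel_measurable_const
            measurable_component_singleton) auto
    qed simp
    then have "indep_var borel (\<lambda>\<omega>. ?c n * X 1 \<omega>) borel N"
      by (simp add: comp_def N_def)
    then have "distributed M lborel (\<lambda>\<omega>. ?c n * X 1 \<omega> + N \<omega>)
      (normal_density (0 + 0) (sqrt ((?c n * ?s)\<^sup>2 + (sqrt (\<Sum>j=2..n. (?c (Suc n - j))\<^sup>2))\<^sup>2)))"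
      using c_pos[OF assms] s_pos noise_pos
      by (intro add_indep_normal initial noise mult_pos_pos) auto
    moreover have "(sqrt (\<Sum>j=2..n. (?c (Suc n - j))\<^sup>2))\<^sup>2 = (\<Sum>j=2..n. (?c (Suc n - j))\<^sup>2)"
      using noise_pos by simp
    ultimately show ?thesis
      unfolding initial_var by (simp add: partial_sum_variance_def N_def)
  qed
qed

lemma partial_sum_variance_pos: "1 \<le> n \<Longrightarrow> 0 < partial_sum_variance \<theta> n"
  unfolding partial_sum_variance_def
  using geometric_weight_pos[OF abs_theta_less_1, of n] one_minus_theta_sq_pos
  by (intro add_pos_nonneg sum_nonneg) auto

lemma sample_mean_distributed:
  assumes "1 \<le> n"
  shows "distributed M lborel (sample_mean X n)
    (normal_density 0 (sqrt (partial_sum_variance \<theta> n) / real n))"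
proof -
  let ?S = "\<lambda>\<omega>. geometric_weight \<theta> n * X 1 \<omega>
    + (\<Sum>j=2..n. geometric_weight \<theta> (Suc n - j) * \<epsilon> j \<omega>)"
  have D: "distributed M lborel (\<lambda>\<omega>. 1 / real n * ?S \<omega>)
      (normal_density 0 (sqrt (partial_sum_variance \<theta> n) / real n))"
    using normal_density_affine[OF partial_sum_distributed[OF assms], of "1 / real n" 0]
      partial_sum_variance_pos[OF assms] assms by simp
  have eq: "sample_mean X n \<omega> = 1 / real n * ?S \<omega>" if "\<omega> \<in> space M" for \<omega>
    unfolding sample_mean_def partial_sum_eq[OF that] ..
  show ?thesis
    using D unfolding distributed_def
    by (simp only: eq cong: distr_cong measurable_cong)
qed

lemma sample_mean_satisfies_LDP:
  "satisfies_LDP M (sample_mean X) (\<lambda>c. ereal (c\<^sup>2 * ((1 - \<theta>)\<^sup>2 / 2)))"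
proof -
  let ?\<sigma> = "\<lambda>n. sqrt (partial_sum_variance \<theta> n) / real n"
  have "eventually (\<lambda>n. partial_sum_variance \<theta> n / real n = real n * (?\<sigma> n)\<^sup>2) sequentially"
    using eventually_ge_at_top[of 1]
  proof eventually_elim
    case (elim n)
    then show ?case
      using partial_sum_variance_pos[of n] by (simp add: power_divide power2_eq_square)
  qed
  then have "(\<lambda>n. real n * (?\<sigma> n)\<^sup>2) \<longlonglongrightarrow> 1 / (1 - \<theta>)\<^sup>2"
    using partial_sum_variance_asymp[OF abs_theta_less_1] by (rule Lim_transform_eventually[rotated])
  then have "satisfies_LDP M (sample_mean X) (\<lambda>c. ereal (c\<^sup>2 * (1 / (2 * (1 / (1 - \<theta>)\<^sup>2)))))"
    using abs_theta_less_1 partial_sum_variance_pos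
    by (intro centred_normal_satisfies_LDP[where \<sigma> = ?\<sigma>] sample_mean_distributed) auto
  then show ?thesis by simp
qed

end

theorem mainTheorem6:
  fixes M :: "'a measure" and \<theta> :: real and X \<epsilon> :: "nat \<Rightarrow> 'a \<Rightarrow> real"
  assumes "\<theta> \<in> {-1<..<1}"
    and "stationary_gaussian_AR1 M \<theta> X \<epsilon>"
  shows "satisfies_LDP M (sample_mean X) (\<lambda>c. ereal (c\<^sup>2 * (1 - \<theta>)\<^sup>2 / 2)) \<and>
    good_rate_function (\<lambda>c. ereal (c\<^sup>2 * (1 - \<theta>)\<^sup>2 / 2))"
proof -
  interpret stationary_gaussian_AR1 M \<theta> X \<epsilon> by fact
  have "0 < (1 - \<theta>)\<^sup>2 / 2" using assms(1) by simp
  then show ?thesis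
    using sample_mean_satisfies_LDP good_rate_function_quadratic[of "(1 - \<theta>)\<^sup>2 / 2"] by simp
qed

end
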